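(* For any connected graph $G$ of order $n\ge 3$ and size $m$ (i.e. with $n$ vertices and $m$ edges), $$\gamma_{rI}(G)\ \ge\ \min\left\{\gamma_{rR}(G),\ n-\frac{2m}{5},\ n-\frac{2m-5}{3}\right\}.$$
   Context: All graphs are finite and simple. For $f:V(G)\to\{0,1,2\}$, the weight is $\omega(f)=\sum_{v\in V(G)}f(v)$ and $V_i=\{v: f(v)=i\}$. An Italian dominating function of $G$ is a function $f:V(G)\to\{0,1,2\}$ such that every $v$ with $f(v)=0$ satisfies $\sum_{u\in N(v)}f(u)\ge 2$. A restrained Italian dominating (RID) function is an Italian dominating function for which the induced subgraph $G[V_0]$ has no isolated vertices; $\gamma_{rI}(G)$ is the minimum weight of an RID function of $G$. A Roman dominating function of $G$ is a function $f:V(G)\to\{0,1,2\}$ such that every vertex $v$ with $f(v)=0$ has a neighbor $w$ with $f(w)=2$. A restrained Roman dominating function is a Roman dominating function for which $G[V_0]$ has no isolated vertices; $\gamma_{rR}(G)$ is the minimum weight of a restrained Roman dominating function of $G$. *)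

theory Defs
  imports Complex_Main "Graph_Theory.Digraph_Component"
begin

text \<open>
  A finite simple graph is a \<^locale>\<open>graph\<close>: a finite symmetric digraph without loops and
  without parallel arcs. An undirected edge is thus a pair of opposite arcs, and the size of
  the graph counts unordered pairs of adjacent vertices rather than arcs.
\<close>

definition graph_order :: "('a, 'b) pre_digraph \<Rightarrow> nat" where
  "graph_order G = card (verts G)"

definition edges :: "('a, 'b) pre_digraph \<Rightarrow> 'a set set" where
  "edges G = {{u, v} |u v. u \<rightarrow>\<^bsub>G\<^esub> v}"

definition graph_size :: "('a, 'b) pre_digraph \<Rightarrow> nat" where
  "graph_size G = card (edges G)"

definition nbhd :: "('a, 'b) pre_digraph \<Rightarrow> 'a \<Rightarrow> 'a set" where
  "nbhd G v = {u. v \<rightarrow>\<^bsub>G\<^esub> u}"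

definition no_isolated_vertices :: "('a, 'b) pre_digraph \<Rightarrow> bool" where
  "no_isolated_vertices H \<longleftrightarrow> (\<forall>v \<in> verts H. nbhd H v \<noteq> {})"

text \<open>Labellings are total on the vertex type; only their values on \<^term>\<open>verts G\<close> matter.\<close>

definition weight :: "('a, 'b) pre_digraph \<Rightarrow> ('a \<Rightarrow> nat) \<Rightarrow> nat" where
  "weight G f = (\<Sum>v \<in> verts G. f v)"

definition level :: "('a, 'b) pre_digraph \<Rightarrow> ('a \<Rightarrow> nat) \<Rightarrow> nat \<Rightarrow> 'a set" where
  "level G f i = {v \<in> verts G. f v = i}"

definition italian_dominating :: "('a, 'b) pre_digraph \<Rightarrow> ('a \<Rightarrow> nat) \<Rightarrow> bool" where
  "italian_dominating G f \<longleftrightarrow> f ` verts G \<subseteq> {0, 1, 2} \<and>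
     (\<forall>v \<in> verts G. f v = 0 \<longrightarrow> (\<Sum>u \<in> nbhd G v. f u) \<ge> 2)"

definition roman_dominating :: "('a, 'b) pre_digraph \<Rightarrow> ('a \<Rightarrow> nat) \<Rightarrow> bool" where
  "roman_dominating G f \<longleftrightarrow> f ` verts G \<subseteq> {0, 1, 2} \<and>
     (\<forall>v \<in> verts G. f v = 0 \<longrightarrow> (\<exists>w \<in> nbhd G v. f w = 2))"

definition restrained_italian_dominating :: "('a, 'b) pre_digraph \<Rightarrow> ('a \<Rightarrow> nat) \<Rightarrow> bool" where
  "restrained_italian_dominating G f \<longleftrightarrow>
     italian_dominating G f \<and> no_isolated_vertices (G \<restriction> level G f 0)"

definition restrained_roman_dominating :: "('a, 'b) pre_digraph \<Rightarrow> ('a \<Rightarrow> nat) \<Rightarrow> bool" where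
  "restrained_roman_dominating G f \<longleftrightarrow>
     roman_dominating G f \<and> no_isolated_vertices (G \<restriction> level G f 0)"

definition gamma_rI :: "('a, 'b) pre_digraph \<Rightarrow> nat" where
  "gamma_rI G = (LEAST w. \<exists>f. restrained_italian_dominating G f \<and> weight G f = w)"

definition gamma_rR :: "('a, 'b) pre_digraph \<Rightarrow> nat" where
  "gamma_rR G = (LEAST w. \<exists>f. restrained_roman_dominating G f \<and> weight G f = w)"

text \<open>Both minima range over nonempty sets, since the constant labelling 1 is admissible.\<close>

lemma restrained_dominating_const_1:
  "restrained_italian_dominating G (\<lambda>_. 1)" "restrained_roman_dominating G (\<lambda>_. 1)"
  by (auto simp: restrained_italian_dominating_def restrained_roman_dominating_def
      italian_dominating_def roman_dominating_def no_isolated_vertices_def level_def)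

end

theory Submission
  imports Defs
begin

text \<open>
  Let \<open>f\<close> be a restrained Italian dominating function of minimum weight, so that its weight is
  \<open>n - |V\<^sub>0| + |V\<^sub>2|\<close>. Every vertex of \<open>V\<^sub>0\<close> has a neighbour in \<open>V\<^sub>0\<close>. If \<open>V\<^sub>2\<close> is empty, it also
  has two neighbours outside \<open>V\<^sub>0\<close>, hence \<open>2m \<ge> 5|V\<^sub>0|\<close>. Otherwise it has at least one neighbour
  outside \<open>V\<^sub>0\<close>, and either \<open>f\<close> is Roman dominating or some vertex of \<open>V\<^sub>0\<close> has two neighbours
  in \<open>V\<^sub>1\<close>, hence \<open>2m \<ge> 3|V\<^sub>0| + 2 \<ge> 3|V\<^sub>0| - 3|V\<^sub>2| + 5\<close>.
\<close>

lemma ex_weight_gamma_rI: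
  "\<exists>f. restrained_italian_dominating G f \<and> weight G f = gamma_rI G"
  unfolding gamma_rI_def
  by (rule LeastI_ex) (use restrained_dominating_const_1 in blast)

lemma gamma_rR_le_weight:
  "restrained_roman_dominating G f \<Longrightarrow> gamma_rR G \<le> weight G f"
  unfolding gamma_rR_def by (rule Least_le) blast

context wf_digraph
begin

lemma nbhd_subset_verts: "nbhd G v \<subseteq> verts G"
  by (auto simp: nbhd_def adj_in_verts)

lemma nbhd_induce_subgraph:
  assumes "v \<in> S"
  shows "nbhd (G \<restriction> S) v = nbhd G v \<inter> S"
  using assms by (auto simp: nbhd_def arcs_ends_def arc_to_ends_def)

end

context fin_digraph
begin

lemma finite_nbhd: "finite (nbhd G v)"
  using nbhd_subset_verts finite_verts by (rule finite_subset)

text \<open>Forgetting the order maps adjacent pairs onto edges, and the fibre over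
  \<open>{u, v}\<close> lies in \<open>{(u, v), (v, u)}\<close>.\<close>

lemma card_arcs_ends_le: "card (arcs_ends G) \<le> 2 * graph_size G"
proof -
  have edges: "edges G = (\<lambda>(u, v). {u, v}) ` arcs_ends G"
    by (auto simp: edges_def)
  have fin: "finite (arcs_ends G)"
    by (simp add: arcs_ends_def)
  have "card {p \<in> arcs_ends G. (\<lambda>(u, v). {u, v}) p = e} \<le> 2" if "e \<in> edges G" for e
  proof -
    from that obtain u v where e: "e = {u, v}"
      by (auto simp: edges_def)
    have "card {p \<in> arcs_ends G. (\<lambda>(u, v). {u, v}) p = e} \<le> card {(u, v), (v, u)}"
      by (rule card_mono) (simp, clarsimp simp: e doubleton_eq_iff)
    also have "\<dots> \<le> 2"
      by (cases "u = v") simp_all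
    finally show ?thesis .
  qed
  from sum_bounded_above[of "edges G" _ 2, OF this]
  have "(\<Sum>e \<in> edges G. card {p \<in> arcs_ends G. (\<lambda>(u, v). {u, v}) p = e}) \<le> 2 * card (edges G)"
    by (simp add: mult.commute)
  moreover have "card (arcs_ends G) =
      (\<Sum>e \<in> edges G. card {p \<in> arcs_ends G. (\<lambda>(u, v). {u, v}) p = e})"
    using sum.group[OF fin, of "edges G" "\<lambda>(u, v). {u, v}" "\<lambda>_. 1::nat"] fin edges by simp
  ultimately show ?thesis
    by (simp add: graph_size_def)
qed

text \<open>On 0, 1, 2, a label plus the indicator of 0 is 1 plus the indicator of 2. The additive
  form avoids truncated subtraction.\<close>

lemma weight_add_card_level_0:
  assumes "f ` verts G \<subseteq> {0, 1, 2}"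
  shows "weight G f + card (level G f 0) = graph_order G + card (level G f 2)"
proof -
  have card: "card (level G f i) = (\<Sum>v \<in> verts G. if f v = i then 1 else 0)" for i
    by (simp add: level_def flip: sum.inter_filter)
  have "(\<Sum>v \<in> verts G. f v + (if f v = 0 then 1 else 0)) =
      (\<Sum>v \<in> verts G. 1 + (if f v = 2 then 1 else 0))"
    using assms by (intro sum.cong) auto
  then show ?thesis
    unfolding weight_def card graph_order_def sum.distrib by simp
qed

text \<open>Neighbours labelled 0 add nothing to the sum, so the others supply all of it:
  \<open>k = 1\<close> forces two of them, \<open>k = 2\<close> one.\<close>

lemma italian_dominating_card_nbhd_outside:
  assumes "italian_dominating G f" "v \<in> level G f 0" "\<And>u. u \<in> nbhd G v \<Longrightarrow> f u \<le> k"
  shows "2 \<le> card (nbhd G v - level G f 0) * k"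
proof -
  have "2 \<le> (\<Sum>u \<in> nbhd G v. f u)"
    using assms(1,2) by (auto simp: italian_dominating_def level_def)
  also have "\<dots> = (\<Sum>u \<in> nbhd G v - level G f 0. f u)"
    using finite_nbhd by (intro sum.mono_neutral_right) (auto simp: level_def)
  also have "\<dots> \<le> card (nbhd G v - level G f 0) * k"
    using assms(3) sum_bounded_above[of "nbhd G v - level G f 0" f k] by simp
  finally show ?thesis .
qed

end

context graph
begin

text \<open>Each edge between \<open>S\<close> and its complement gives two arcs, but only one of them is seen from \<open>S\<close>.\<close>

lemma sum_card_nbhd_le_size:
  assumes "S \<subseteq> verts G"
  shows "(\<Sum>v \<in> S. card (nbhd G v \<inter> S)) + 2 * (\<Sum>v \<in> S. card (nbhd G v - S)) \<le> 2 * graph_size G"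
proof -
  let ?A = "SIGMA v:S. nbhd G v \<inter> S" and ?B = "SIGMA v:S. nbhd G v - S"
  have finS: "finite S"
    using assms finite_verts by (rule finite_subset)
  have fin: "finite ?A" "finite ?B"
    using finS finite_nbhd by auto
  have "card ?A + 2 * card ?B = card ?A + (card ?B + card (?B\<inverse>))"
    by simp
  \<comment> \<open>The three sets are disjoint: their pairs stay in \<open>S\<close>, leave
    \<open>S\<close> and enter \<open>S\<close>, respectively.\<close>
  also have "\<dots> = card (?A \<union> (?B \<union> ?B\<inverse>))"
    using fin by (subst card_Un_disjoint; (subst card_Un_disjoint)?) auto
  also have "\<dots> \<le> card (arcs_ends G)"
  proof (rule card_mono)
    show "finite (arcs_ends G)"
      by (simp add: arcs_ends_def)
    show "?A \<union> (?B \<union> ?B\<inverse>) \<subseteq> arcs_ends G"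
      using graph_symmetric by (auto simp: nbhd_def)
  qed
  also note card_arcs_ends_le
  finally show ?thesis
    using finS finite_nbhd by simp
qed

text \<open>The last two disjuncts are the real bounds with denominators cleared, so that the
  counting stays in the naturals.\<close>

lemma restrained_italian_dominating_weight_ge:
  assumes f: "restrained_italian_dominating G f"
  shows "restrained_roman_dominating G f \<or>
    5 * graph_order G \<le> 5 * weight G f + 2 * graph_size G \<or>
    3 * graph_order G + 5 \<le> 3 * weight G f + 2 * graph_size G"
proof -
  let ?S = "level G f 0"
  let ?out = "\<lambda>v. card (nbhd G v - ?S)"
  have ital: "italian_dominating G f" and iso: "no_isolated_vertices (G \<restriction> ?S)"
    using f by (auto simp: restrained_italian_dominating_def)
  have range: "f ` verts G \<subseteq> {0, 1, 2}"
    using ital by (simp add: italian_dominating_def)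
  have nbhd_le_2: "f u \<le> 2" if "u \<in> nbhd G v" for u v
    using that range nbhd_subset_verts[of v] by fastforce
  have sub: "?S \<subseteq> verts G"
    by (auto simp: level_def)
  have finS: "finite ?S"
    using sub finite_verts by (rule finite_subset)
  have "1 \<le> card (nbhd G v \<inter> ?S)" if "v \<in> ?S" for v
    using iso that finite_nbhd[of v]
    by (auto simp: no_isolated_vertices_def nbhd_induce_subgraph Suc_le_eq card_gt_0_iff)
  then have "card ?S \<le> (\<Sum>v \<in> ?S. card (nbhd G v \<inter> ?S))"
    using sum_mono[of ?S "\<lambda>_. 1" "\<lambda>v. card (nbhd G v \<inter> ?S)"] by simp
  then have size: "card ?S + 2 * sum ?out ?S \<le> 2 * graph_size G"
    using sum_card_nbhd_le_size[OF sub] by linarith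
  note weight = weight_add_card_level_0[OF range]
  \<comment> \<open>This serves both the case of empty \<open>level G f 2\<close> and a vertex
    violating the Roman condition.\<close>
  have out2: "2 \<le> ?out v" if "v \<in> ?S" "\<And>u. u \<in> nbhd G v \<Longrightarrow> f u \<noteq> 2" for v
  proof -
    have "f u \<le> 1" if "u \<in> nbhd G v" for u
      using nbhd_le_2[of u v] that \<open>\<And>u. u \<in> nbhd G v \<Longrightarrow> f u \<noteq> 2\<close>[of u] by linarith
    then show ?thesis
      using italian_dominating_card_nbhd_outside[OF ital that(1), of 1] by simp
  qed
  show ?thesis
  proof (cases "level G f 2 = {}")
    case True
    then have "2 \<le> ?out v" if "v \<in> ?S" for v
      using that nbhd_subset_verts[of v] by (intro out2) (auto simp: level_def)
    then have "2 * card ?S \<le> sum ?out ?S"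
      using sum_mono[of ?S "\<lambda>_. 2" ?out] by (simp add: mult.commute)
    \<comment> \<open>The factor 5 in \<open>5 * card ?S \<le> 2 * graph_size G\<close> is 1 + 2 *
      2.\<close>
    then show ?thesis
      using size weight True by simp
  next
    case False
    have "finite (level G f 2)"
      by (simp add: level_def)
    with False have card2: "1 \<le> card (level G f 2)"
      by (simp add: Suc_le_eq card_gt_0_iff)
    show ?thesis
    proof (cases "roman_dominating G f")
      case True
      then show ?thesis
        using iso by (simp add: restrained_roman_dominating_def)
    next
      case False
      then obtain w where w: "w \<in> ?S" "\<And>u. u \<in> nbhd G w \<Longrightarrow> f u \<noteq> 2"
        using range by (auto simp: roman_dominating_def level_def)
      have "1 \<le> ?out v" if "v \<in> ?S" for v
        using italian_dominating_card_nbhd_outside[OF ital that, of 2] nbhd_le_2 by simp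
      \<comment> \<open>\<open>w\<close> is split off because its second outside neighbour yields
        the surplus 1.\<close>
      then have "card (?S - {w}) \<le> sum ?out (?S - {w})"
        using sum_mono[of "?S - {w}" "\<lambda>_. 1" ?out] by simp
      moreover have "sum ?out ?S = ?out w + sum ?out (?S - {w})"
        using finS w(1) by (rule sum.remove)
      moreover have "card ?S = Suc (card (?S - {w}))"
        using finS w(1) by (rule card.remove)
      ultimately have "card ?S + 1 \<le> sum ?out ?S"
        using out2[OF w] by linarith
      \<comment> \<open>The constant 5 is 2 from the surplus, doubled in \<open>size\<close>, plus 3
        from \<open>card2\<close> in the tripled \<open>weight\<close>.\<close>
      then show ?thesis
        using size weight card2 by linarith
    qed
  qed
qed

end

theorem proposition2p2:
  fixes G :: "('a, 'b) pre_digraph" and n m :: nat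
  assumes "graph G"
    and "Digraph_Component.connected G"
    and "graph_order G = n"
    and "graph_size G = m"
    and "n \<ge> 3"
  shows "real (gamma_rI G) \<ge>
    Min {real (gamma_rR G), real n - 2 * real m / 5, real n - (2 * real m - 5) / 3}"
proof -
  obtain f where f: "restrained_italian_dominating G f" "weight G f = gamma_rI G"
    using ex_weight_gamma_rI by blast
  \<comment> \<open>Each case puts one member of the set below \<open>gamma_rI G\<close>, which
    bounds the minimum.\<close>
  consider "restrained_roman_dominating G f"
    | "5 * n \<le> 5 * gamma_rI G + 2 * m"
    | "3 * n + 5 \<le> 3 * gamma_rI G + 2 * m"
    using graph.restrained_italian_dominating_weight_ge[OF assms(1) f(1)] f(2) assms(3,4) by auto
  then show ?thesis
  proof cases
    case 1
    then show ?thesis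
      using gamma_rR_le_weight f(2) by (fastforce simp: Min_le_iff)
  next
    case 2
    then have "real n - 2 * real m / 5 \<le> real (gamma_rI G)"
      by linarith
    then show ?thesis
      by (simp add: Min_le_iff)
  next
    case 3
    then have "real n - (2 * real m - 5) / 3 \<le> real (gamma_rI G)"
      by (simp add: field_simps)
    then show ?thesis
      by (simp add: Min_le_iff)
  qed
qed

end
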